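(* Let $a\ge 1$ and $0\le b\le a$ be integers with $a\equiv b\pmod 2$, let $\sigma\in\{\text{sink},\text{source}\}$ (with $\sigma=\text{sink}$ when $b=0$), and let $k=\frac{a-b}{2}$ if $\sigma=\text{sink}$ and $k=\frac{a+b}{2}$ if $\sigma=\text{source}$. Consider the experiment graph $\mathtt{G}(a,b,\sigma)$ with signal paths $A$ and spectator paths $B$. Every coincidence $M$ of $\mathtt{G}(a,b,\sigma)$ registers exactly $k$ excitations, all of them on signal paths, and every spectator path registers $0$ in every coincidence; that is, $|\operatorname{sig}(M)|=k$ and $\operatorname{sig}(M)\subseteq A$. Equivalently, the state $\left|\psi_{\mathtt{G}(a,b,\sigma)}\right\rangle$ is supported on the weight-$k$ sector of the signal modes tensored with the vacuum $\left|0\right\rangle^{\otimes b}$ on $B$.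
   Context: An experiment graph is a finite loopless multigraph $G=(V,E)$ (vertices are called paths, edges are called crystals; parallel edges are distinct crystals) together with a half-edge coloring assigning to each of the two arms (edge–endpoint incidences) of each crystal a mode: excited ($1$) or ground ($0$). For a crystal $e$, $R(e)$ is the set of endpoints of $e$ at which the arm of $e$ is excited. A coincidence is a perfect matching $M$ of $G$ (a set of edges covering every vertex exactly once). The registered pattern of a coincidence $M$ is $\operatorname{sig}(M)=\bigsqcup_{e\in M}R(e)\subseteq V$, identified with the bitstring in $\{0,1\}^V$ that is its indicator vector; path $i$ registers $1$ if $i\in\operatorname{sig}(M)$ and $0$ otherwise, and the number of excitations registered by $M$ is $|\operatorname{sig}(M)|$. All crystals have weight $1$. The (unnormalized) post-selected state is $\left|\psi_G\right\rangle\propto\sum_{M}\left|\operatorname{sig}(M)\right\rangle$, the sum being over all perfect matchings $M$ of $G$, where $\left|x\right\rangle$ is the computational basis vector indexed by $x\in\{0,1\}^V$. The experiment graph $\mathtt{G}(a,b,\sigma)$: its vertex set is the disjoint union $A\sqcup B$ with $|A|=a$ (signal paths) and $|B|=b$ (spectator paths). For each pair $\{i,j\}\subseteq A$ with $i\ne j$ there are exactly two parallel crystals, one excited at $i$ and ground at $j$, the other ground at $i$ and excited at $j$. There are no crystals between two vertices of $B$. Each $v\in B$ is joined to each $i\in A$ by a single crystal, which is ground at both $i$ and $v$ if $\sigma=\text{sink}$, and excited at $i$ and ground at $v$ if $\sigma=\text{source}$. *)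

theory Defs
  imports Complex_Main "HOL-Library.FuncSet" "HOL-Library.Disjoint_Sets"
begin

section \<open>Experiment graphs\<close>

text \<open>
  The crystals of the multigraph are abstract labels of type \<open>'e\<close>, so that parallel crystals are
  distinct. The colouring \<open>excited G e v\<close> only matters when \<open>v\<close> is an endpoint of \<open>e\<close>:
  true stands for mode 1 (excited), false for mode 0 (ground).
\<close>

record ('v, 'e) experiment_graph =
  paths :: "'v set"
  crystals :: "'e set"
  ends :: "'e \<Rightarrow> 'v set"
  excited :: "'e \<Rightarrow> 'v \<Rightarrow> bool"

locale experiment_graph =
  fixes G :: "('v, 'e) experiment_graph"
  assumes finite_paths: "finite (paths G)"
    and finite_crystals: "finite (crystals G)"
    and ends_subset: "e \<in> crystals G \<Longrightarrow> ends G e \<subseteq> paths G"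
    and card_ends: "e \<in> crystals G \<Longrightarrow> card (ends G e) = 2"

definition R :: "('v, 'e) experiment_graph \<Rightarrow> 'e \<Rightarrow> 'v set" where
  "R G e = {v \<in> ends G e. excited G e v}"

definition coincidence :: "('v, 'e) experiment_graph \<Rightarrow> 'e set \<Rightarrow> bool" where
  "coincidence G M \<longleftrightarrow>
     M \<subseteq> crystals G \<and> (\<forall>v\<in>paths G. \<exists>!e. e \<in> M \<and> v \<in> ends G e)"

definition sig :: "('v, 'e) experiment_graph \<Rightarrow> 'e set \<Rightarrow> 'v set" where
  "sig G M = (\<Union>e\<in>M. R G e)"

text \<open>For a coincidence, the union defining \<open>sig\<close> is disjoint.\<close>

lemma (in experiment_graph) disjoint_R:
  assumes "coincidence G M"
  shows "disjoint_family_on (R G) M"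
  using assms ends_subset unfolding disjoint_family_on_def coincidence_def R_def by blast


section \<open>Bitstrings and states\<close>

text \<open>
  Bitstrings in \<open>{0,1}\<^sup>V\<close> are extensional functions on \<open>V\<close>. A vector is given by its
  amplitudes, which vanish off the bitstrings on the relevant set of modes.
\<close>

definition bitstrings :: "'v set \<Rightarrow> ('v \<Rightarrow> nat) set" where
  "bitstrings V = V \<rightarrow>\<^sub>E {0, 1}"

definition weight :: "'v set \<Rightarrow> ('v \<Rightarrow> nat) \<Rightarrow> nat" where
  "weight V x = (\<Sum>v\<in>V. x v)"

definition registered :: "('v, 'e) experiment_graph \<Rightarrow> 'e set \<Rightarrow> 'v \<Rightarrow> nat" where
  "registered G M = (\<lambda>v\<in>paths G. if v \<in> sig G M then 1 else 0)"

type_synonym 'v state = "('v \<Rightarrow> nat) \<Rightarrow> complex"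

definition ket :: "('v \<Rightarrow> nat) \<Rightarrow> 'v state" where
  "ket x = (\<lambda>y. if y = x then 1 else 0)"

text \<open>The unnormalized post-selected state, all crystals having weight 1.\<close>

definition psi :: "('v, 'e) experiment_graph \<Rightarrow> 'v state" where
  "psi G = (\<lambda>x. \<Sum>M | coincidence G M. ket (registered G M) x)"

definition vacuum :: "'v set \<Rightarrow> 'v state" where
  "vacuum V = ket (\<lambda>v\<in>V. 0)"

text \<open>Tensor product of a vector on the modes \<open>A\<close> and a vector on the modes \<open>B\<close>, for disjoint
  \<open>A\<close> and \<open>B\<close>.\<close>

definition tensor :: "'v set \<Rightarrow> 'v set \<Rightarrow> 'v state \<Rightarrow> 'v state \<Rightarrow> 'v state" where
  "tensor A B \<phi> \<chi> =
     (\<lambda>x. if x \<in> bitstrings (A \<union> B) then \<phi> (restrict x A) * \<chi> (restrict x B) else 0)"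

definition weight_sector :: "'v set \<Rightarrow> nat \<Rightarrow> 'v state set" where
  "weight_sector V k = {\<phi>. \<forall>x. \<phi> x \<noteq> 0 \<longrightarrow> x \<in> bitstrings V \<and> weight V x = k}"


section \<open>The graphs \<open>G(a,b,\<sigma>)\<close>\<close>

datatype spectator_type = Sink | Source

text \<open>
  \<open>Signal i j\<close> is the crystal on \<open>{i,j}\<close> excited at \<open>i\<close> and ground at \<open>j\<close>, so the two parallel
  crystals on this pair are \<open>Signal i j\<close> and \<open>Signal j i\<close>. \<open>Spectator v i\<close> joins \<open>v \<in> B\<close>
  to \<open>i \<in> A\<close>.
\<close>

datatype 'v crystal = Signal 'v 'v | Spectator 'v 'v

fun GG_ends :: "'v crystal \<Rightarrow> 'v set" where
  "GG_ends (Signal i j) = {i, j}"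
| "GG_ends (Spectator v i) = {v, i}"

fun GG_excited :: "spectator_type \<Rightarrow> 'v crystal \<Rightarrow> 'v \<Rightarrow> bool" where
  "GG_excited \<sigma> (Signal i j) x \<longleftrightarrow> x = i"
| "GG_excited \<sigma> (Spectator v i) x \<longleftrightarrow> \<sigma> = Source \<and> x = i"

definition GG ::
  "'v set \<Rightarrow> 'v set \<Rightarrow> spectator_type \<Rightarrow> ('v, 'v crystal) experiment_graph" where
  "GG A B \<sigma> =
     \<lparr>paths = A \<union> B,
      crystals = {Signal i j | i j. i \<in> A \<and> j \<in> A \<and> i \<noteq> j} \<union> {Spectator v i | v i. v \<in> B \<and> i \<in> A},
      ends = GG_ends,
      excited = GG_excited \<sigma>\<rparr>"

lemma experiment_graph_GG:
  assumes "finite A" "finite B" "A \<inter> B = {}"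
  shows "experiment_graph (GG A B \<sigma>)"
proof
  have "crystals (GG A B \<sigma>) \<subseteq> case_prod Signal ` (A \<times> A) \<union> case_prod Spectator ` (B \<times> A)"
    by (auto simp: GG_def)
  then show "finite (crystals (GG A B \<sigma>))"
    by (rule finite_subset) (use assms in auto)
next
  fix e assume "e \<in> crystals (GG A B \<sigma>)"
  then show "card (ends (GG A B \<sigma>) e) = 2"
    using assms(3) by (auto simp: GG_def card_insert_if)
qed (use assms in \<open>auto simp: GG_def\<close>)

end

(* Every crystal e of GG A B \<sigma> satisfies a linear relation between |R(e)|, |ends e \<inter> A| and
   |ends e \<inter> B|, namely |ends e \<inter> A| = 2|R(e)| + |ends e \<inter> B| for a sink and
   2|R(e)| = |ends e \<inter> A| + |ends e \<inter> B| for a source. Summing over a coincidence turns these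
   into a = 2|sig M| + b and 2|sig M| = a + b. *)

theory Submission
  imports Defs
begin

context experiment_graph
begin

lemma disjoint_ends:
  assumes "coincidence G M"
  shows "disjoint_family_on (ends G) M"
  using assms ends_subset unfolding disjoint_family_on_def coincidence_def by blast

lemma finite_coincidence:
  assumes "coincidence G M"
  shows "finite M"
  using assms finite_crystals finite_subset unfolding coincidence_def by blast

lemma finite_ends:
  assumes "e \<in> crystals G"
  shows "finite (ends G e)"
  using assms ends_subset finite_paths finite_subset by blast

text \<open>The end sets of a coincidence partition the paths, so they cut \<open>X\<close> into
  disjoint pieces. Taking \<open>X = A\<close> and \<open>X = B\<close> separately lets signal and
  spectator paths be counted crystal by crystal.\<close>

lemma card_eq_sum_ends:
  assumes M: "coincidence G M" and X: "X \<subseteq> paths G"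
  shows "card X = (\<Sum>e\<in>M. card (ends G e \<inter> X))"
proof -
  have "X = (\<Union>e\<in>M. ends G e \<inter> X)"
    using M X unfolding coincidence_def by blast
  then have "card X = card (\<Union>e\<in>M. ends G e \<inter> X)"
    by simp
  also have "\<dots> = (\<Sum>e\<in>M. card (ends G e \<inter> X))"
  proof (rule card_UN_disjoint)
    show "\<forall>e\<in>M. finite (ends G e \<inter> X)"
      using M finite_ends unfolding coincidence_def by blast
    show "\<forall>e\<in>M. \<forall>e'\<in>M. e \<noteq> e' \<longrightarrow> (ends G e \<inter> X) \<inter> (ends G e' \<inter> X) = {}"
      using disjoint_ends[OF M] unfolding disjoint_family_on_def by blast
  qed (rule finite_coincidence[OF M])
  finally show ?thesis .
qed

lemma card_sig_eq_sum_R: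
  assumes M: "coincidence G M"
  shows "card (sig G M) = (\<Sum>e\<in>M. card (R G e))"
  unfolding sig_def
proof (rule card_UN_disjoint)
  show "\<forall>e\<in>M. finite (R G e)"
    using M finite_ends unfolding coincidence_def R_def by auto
  show "\<forall>e\<in>M. \<forall>e'\<in>M. e \<noteq> e' \<longrightarrow> R G e \<inter> R G e' = {}"
    using disjoint_R[OF M] unfolding disjoint_family_on_def by blast
qed (rule finite_coincidence[OF M])

end

lemma registered_bitstring: "registered G M \<in> bitstrings (paths G)"
  by (auto simp: registered_def bitstrings_def)

text \<open>Measuring only on \<open>X\<close> loses no excitation, since all of them lie in
  \<open>X\<close>; applied to the signal paths \<open>X = A\<close>.\<close>

lemma weight_registered:
  assumes "finite X" "sig G M \<subseteq> X" "X \<subseteq> paths G"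
  shows "weight X (registered G M) = card (sig G M)"
proof -
  have "weight X (registered G M) = (\<Sum>v\<in>X. if v \<in> sig G M then 1 else 0)"
    unfolding weight_def using assms(3) by (intro sum.cong) (auto simp: registered_def)
  also have "\<dots> = card (sig G M)"
    using assms(1,2) by (simp add: sum.If_cases Int_absorb1)
  finally show ?thesis .
qed

text \<open>A nonzero sum has a nonzero term, and a ket is nonzero only at its own label.\<close>

lemma psi_nonzeroE:
  assumes "psi G x \<noteq> 0"
  obtains M where "coincidence G M" "x = registered G M"
proof -
  obtain M where "coincidence G M" "ket (registered G M) x \<noteq> 0"
    using assms sum.not_neutral_contains_not_neutral unfolding psi_def by blast
  then show thesis
    using that by (auto simp: ket_def split: if_splits)
qed

text \<open>Passes from coincidences to states for any graph on \<open>A \<union> B\<close>: the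
  signal factor is \<open>psi G\<close> read along the embedding that pads a bitstring on
  \<open>A\<close> with zeros on \<open>B\<close>.\<close>

lemma psi_eq_tensor_vacuum:
  assumes V: "paths G = A \<union> B" and AB: "finite A" "A \<inter> B = {}"
    and sig: "\<And>M. coincidence G M \<Longrightarrow> sig G M \<subseteq> A \<and> card (sig G M) = k"
  shows "\<exists>\<phi>\<in>weight_sector A k. psi G = tensor A B \<phi> (vacuum B)"
proof -
  define ext :: "('a \<Rightarrow> nat) \<Rightarrow> 'a \<Rightarrow> nat"
    where "ext y = (\<lambda>v\<in>A \<union> B. if v \<in> A then y v else 0)" for y
  \<comment> \<open>\<open>ext y\<close> sees only the values of \<open>y\<close> on
    \<open>A\<close>; the guard makes \<open>\<phi>\<close> vanish at functions that are not
    extensional on \<open>A\<close>.\<close>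
  define \<phi> where "\<phi> y = (if y \<in> bitstrings A then psi G (ext y) else 0)" for y
  have "\<phi> \<in> weight_sector A k"
    unfolding weight_sector_def
  proof (intro CollectI allI impI conjI)
    fix y assume y: "\<phi> y \<noteq> 0"
    then show "y \<in> bitstrings A"
      by (simp add: \<phi>_def split: if_splits)
    obtain M where M: "coincidence G M" "ext y = registered G M"
      using y psi_nonzeroE unfolding \<phi>_def by metis
    have "weight A y = weight A (ext y)"
      unfolding weight_def ext_def by (intro sum.cong) auto
    also have "\<dots> = k"
      using weight_registered[of A G M] sig[OF M(1)] AB V M(2) by simp
    finally show "weight A y = k" .
  qed
  moreover have "psi G x = tensor A B \<phi> (vacuum B) x" for x
  \<comment> \<open>The condition says exactly that the guard of \<open>tensor\<close> and the
    vacuum factor are both nonzero at \<open>x\<close>. Otherwise the product vanishes, and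
    \<open>psi G x\<close> has to be shown to vanish too.\<close>
  proof (cases "x \<in> bitstrings (A \<union> B) \<and> restrict x B = (\<lambda>v\<in>B. 0)")
    case True
    then have x: "x \<in> bitstrings (A \<union> B)" and zero: "v \<in> B \<Longrightarrow> x v = 0" for v
      by (auto dest: fun_cong[of _ _ v])
    have rA: "restrict x A \<in> bitstrings A"
      using x by (auto simp: bitstrings_def PiE_def Pi_def)
    \<comment> \<open>Since \<open>x\<close> is zero on \<open>B\<close>, padding undoes the
      restriction, so \<open>\<phi>\<close> takes the value \<open>psi G x\<close> there.\<close>
    have "ext (restrict x A) = x"
      using x zero by (auto simp: ext_def bitstrings_def PiE_def extensional_def fun_eq_iff)
    then show ?thesis
      using True rA by (simp add: tensor_def vacuum_def ket_def \<phi>_def)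
  next
    case False
    have "psi G x = 0"
    proof (rule ccontr)
      assume "psi G x \<noteq> 0"
      then obtain M where M: "coincidence G M" "x = registered G M"
        by (rule psi_nonzeroE)
      have "x \<in> bitstrings (A \<union> B)"
        using registered_bitstring[of G M] M(2) V by simp
      \<comment> \<open>\<open>sig G M\<close> lies in \<open>A\<close> and hence misses
        \<open>B\<close>.\<close>
      moreover have "restrict x B = (\<lambda>v\<in>B. 0)"
        using sig[OF M(1)] AB(2) V by (auto simp: M(2) registered_def fun_eq_iff)
      ultimately show False
        using False by blast
    qed
    then show ?thesis
      using False by (auto simp: tensor_def vacuum_def ket_def)
  qed
  ultimately show ?thesis
    by (intro bexI[of _ \<phi>]) auto
qed

lemma R_GG [simp]:
  "R (GG A B \<sigma>) (Signal i j) = {i}"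
  "R (GG A B \<sigma>) (Spectator v i) = (if \<sigma> = Source then {i} else {})"
  by (auto simp: R_def GG_def)

lemma crystals_GG_cases:
  assumes "e \<in> crystals (GG A B \<sigma>)"
  obtains i j where "e = Signal i j" "i \<in> A" "j \<in> A" "i \<noteq> j"
  | v i where "e = Spectator v i" "v \<in> B" "i \<in> A"
  using assms by (auto simp: GG_def)

text \<open>Counting ends in \<open>A\<close>, excitations and ends in \<open>B\<close>: a signal
  crystal gives 2, 1, 0, and a spectator crystal gives 1, 0, 1 for a sink and 1, 1, 1 for a source.
  The sink relation is written additively to avoid truncated subtraction.\<close>

lemma card_crystal_GG:
  assumes e: "e \<in> crystals (GG A B \<sigma>)" and AB: "A \<inter> B = {}"
  shows "if \<sigma> = Sink
    then card (ends (GG A B \<sigma>) e \<inter> A) = 2 * card (R (GG A B \<sigma>) e) + card (ends (GG A B \<sigma>) e \<inter> B)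
    else 2 * card (R (GG A B \<sigma>) e) = card (ends (GG A B \<sigma>) e \<inter> A) + card (ends (GG A B \<sigma>) e \<inter> B)"
  using e
proof (cases rule: crystals_GG_cases)
  case (1 i j)
  then have "ends (GG A B \<sigma>) e \<inter> A = {i, j}" "ends (GG A B \<sigma>) e \<inter> B = {}"
    using AB by (auto simp: GG_def)
  then show ?thesis
    using 1 by (cases \<sigma>) simp_all
next
  case (2 v i)
  then have "ends (GG A B \<sigma>) e \<inter> A = {i}" "ends (GG A B \<sigma>) e \<inter> B = {v}"
    using AB by (auto simp: GG_def)
  then show ?thesis
    using 2 by (cases \<sigma>) simp_all
qed

text \<open>The only end at which a crystal can be excited is a signal path, for both kinds of
  crystal.\<close>

lemma sig_GG_subset:
  assumes "coincidence (GG A B \<sigma>) M"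
  shows "sig (GG A B \<sigma>) M \<subseteq> A"
proof -
  have "R (GG A B \<sigma>) e \<subseteq> A" if "e \<in> M" for e
  proof -
    have "e \<in> crystals (GG A B \<sigma>)"
      using assms that unfolding coincidence_def by blast
    then show ?thesis
      by (cases rule: crystals_GG_cases) auto
  qed
  then show ?thesis
    unfolding sig_def by blast
qed

lemma card_sig_GG:
  assumes fin: "finite A" "finite B" and AB: "A \<inter> B = {}"
    and M: "coincidence (GG A B \<sigma>) M"
  shows "if \<sigma> = Sink then card A = 2 * card (sig (GG A B \<sigma>) M) + card B
    else 2 * card (sig (GG A B \<sigma>) M) = card A + card B"
proof -
  interpret experiment_graph "GG A B \<sigma>"
    using fin AB by (rule experiment_graph_GG)
  let ?G = "GG A B \<sigma>"
  have A: "card A = (\<Sum>e\<in>M. card (ends ?G e \<inter> A))"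
    and B: "card B = (\<Sum>e\<in>M. card (ends ?G e \<inter> B))"
    using card_eq_sum_ends[OF M] by (auto simp: GG_def)
  note S = card_sig_eq_sum_R[OF M]
  have "e \<in> crystals ?G" if "e \<in> M" for e
    using M that unfolding coincidence_def by blast
  note crystal = card_crystal_GG[OF this AB]
  show ?thesis
  proof (cases "\<sigma> = Sink")
    case True
    then have "(\<Sum>e\<in>M. card (ends ?G e \<inter> A)) = (\<Sum>e\<in>M. 2 * card (R ?G e) + card (ends ?G e \<inter> B))"
      using crystal by (intro sum.cong) auto
    then show ?thesis
      using True unfolding A B S by (simp add: sum.distrib sum_distrib_left)
  next
    case False
    then have "(\<Sum>e\<in>M. 2 * card (R ?G e)) = (\<Sum>e\<in>M. card (ends ?G e \<inter> A) + card (ends ?G e \<inter> B))"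
      using crystal by (intro sum.cong) auto
    then show ?thesis
      using False unfolding A B S by (simp add: sum.distrib sum_distrib_left)
  qed
qed

theorem mainTheorem3:
  fixes A B :: "'v set" and a b k :: nat and \<sigma> :: spectator_type
  assumes "finite A" and "finite B" and "A \<inter> B = {}"
    and "card A = a" and "card B = b"
    and "a \<ge> 1" and "b \<le> a" and "a mod 2 = b mod 2"
    and "b = 0 \<longrightarrow> \<sigma> = Sink"
    and "k = (case \<sigma> of Sink \<Rightarrow> (a - b) div 2 | Source \<Rightarrow> (a + b) div 2)"
  shows "(\<forall>M. coincidence (GG A B \<sigma>) M \<longrightarrow>
             card (sig (GG A B \<sigma>) M) = k \<and> sig (GG A B \<sigma>) M \<subseteq> A \<and>
             (\<forall>v\<in>B. registered (GG A B \<sigma>) M v = 0))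
       \<and> (\<exists>\<phi>\<in>weight_sector A k. psi (GG A B \<sigma>) = tensor A B \<phi> (vacuum B))"
proof -
  let ?G = "GG A B \<sigma>"
  have paths: "paths ?G = A \<union> B"
    by (simp add: GG_def)
  \<comment> \<open>The relations of \<open>card_sig_GG\<close> make \<open>a - b\<close> (sink) or
    \<open>a + b\<close> (source) equal to twice the number of excitations, so the subtraction and
    the halving in \<open>k\<close> are exact.\<close>
  have sig: "sig ?G M \<subseteq> A \<and> card (sig ?G M) = k" if "coincidence ?G M" for M
    using sig_GG_subset[OF that] card_sig_GG[OF assms(1-3) that] assms(4,5,10)
    by (cases \<sigma>) auto
  moreover have "registered ?G M v = 0" if "coincidence ?G M" "v \<in> B" for M v
    using sig[OF that(1)] that(2) assms(3) by (auto simp: registered_def paths)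
  ultimately show ?thesis
    using psi_eq_tensor_vacuum[OF paths assms(1,3) sig] by blast
qed

end
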